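(* Let $\pi\in\mathcal C_n(132,213)$ with $\kappa(\pi)=(a_1,a_2,\dots,a_k)$. (1) If $k\ge 2$ and $a_1>a_k\ge 1$, let $\Phi_A(\pi)$ be the permutation with composition $(2a_1-a_k,a_2,\dots,a_{k-1},a_1)$. Then $\Phi_A(\pi)\in\mathcal C_{n+2(a_1-a_k)}(132,213)$. (2) If $k\ge 2$, let $\Phi_B(\pi)$ be the permutation with composition $(a_1+2a_2,a_3,\dots,a_k,a_2)$. Then $\Phi_B(\pi)\in\mathcal C_{n+2a_2}(132,213)$. (3) Let $\Phi_C(\pi)$ be the permutation with composition $(2a_1,a_2,\dots,a_k,a_1)$. Then $\Phi_C(\pi)\in\mathcal C_{n+2a_1}(132,213)$. If $\pi$ is balanced, then the resulting permutation is balanced in each case, provided that, when applying $\Phi_B$, we have $a_1\ne n/2$. Furthermore, each of $\Phi_A$, $\Phi_B$ and $\Phi_C$ is an injection.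
   Context: $\mathcal S_n(132,213)$ is the set of permutations of $[n]=\{1,\dots,n\}$ which, in one-line notation, avoid the patterns $132$ and $213$; $\mathcal C_n(132,213)$ is the subset of those that are cyclic, i.e. whose cycle decomposition is a single cycle of length $n$. For $\sigma\in\mathcal S_p$ and $\tau\in\mathcal S_q$, the skew sum is $\sigma\ominus\tau=(\sigma_1+q)\cdots(\sigma_p+q)\,\tau_1\cdots\tau_q$, and $\mathrm{id}_a=12\cdots a$. Every $\pi\in\mathcal S_n(132,213)$ is uniquely of the form $\mathrm{id}_{a_1}\ominus\cdots\ominus\mathrm{id}_{a_k}$ with $(a_1,\dots,a_k)$ a composition of $n$ (a tuple of positive integers with sum $n$), and every composition of $n$ arises; write $\kappa(\pi)=(a_1,\dots,a_k)$. A permutation in $\mathcal C_{2N}(132,213)$ with composition $(a_1,\dots,a_k)$ is balanced if $a_1+\cdots+a_j=N$ for some $1\le j<k$. The domain of each map $\Phi_A,\Phi_B,\Phi_C$ is the set of all $\pi\in\bigcup_{n\ge1}\mathcal C_n(132,213)$ satisfying the stated condition on $\kappa(\pi)$ in the corresponding item. *)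

theory Defs
  imports "HOL-Combinatorics.Combinatorics" "HOL-Library.Sublist"
begin

text \<open>Permutations of $\{1,\dots,n\}$ are represented in one-line notation, as the lists in
  \<^term>\<open>permutations_of_set {1..n}\<close>; the list determines \<open>n\<close> as its length.\<close>

definition order_isomorphic :: "nat list \<Rightarrow> nat list \<Rightarrow> bool" where
  "order_isomorphic xs ys \<longleftrightarrow> length xs = length ys \<and>
     (\<forall>i<length xs. \<forall>j<length xs. xs ! i < xs ! j \<longleftrightarrow> ys ! i < ys ! j)"

definition avoids :: "nat list \<Rightarrow> nat list \<Rightarrow> bool" where
  "avoids \<pi> \<sigma> \<longleftrightarrow> \<not> (\<exists>xs. subseq xs \<pi> \<and> order_isomorphic xs \<sigma>)"

definition S_av :: "nat \<Rightarrow> nat list set" where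
  "S_av n = {\<pi> \<in> permutations_of_set {1..n}. avoids \<pi> [1,3,2] \<and> avoids \<pi> [2,1,3]}"

text \<open>List positions start at 0, whereas permutations act on $\{1,\dots,n\}$.\<close>

definition perm_fun :: "nat list \<Rightarrow> nat \<Rightarrow> nat" where
  "perm_fun \<pi> i = (if i \<in> {1..length \<pi>} then \<pi> ! (i - 1) else i)"

definition C_av :: "nat \<Rightarrow> nat list set" where
  "C_av n = {\<pi> \<in> S_av n. cyclic_on (perm_fun \<pi>) {1..n}}"

definition skew_sum :: "nat list \<Rightarrow> nat list \<Rightarrow> nat list"  (infixr "\<ominus>" 65) where
  "\<sigma> \<ominus> \<tau> = map (\<lambda>x. x + length \<tau>) \<sigma> @ \<tau>"

definition id_perm :: "nat \<Rightarrow> nat list" where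
  "id_perm a = [1..<Suc a]"

definition is_composition :: "nat \<Rightarrow> nat list \<Rightarrow> bool" where
  "is_composition n as \<longleftrightarrow> (\<forall>a\<in>set as. 0 < a) \<and> sum_list as = n"

definition perm_of_comp :: "nat list \<Rightarrow> nat list" where
  "perm_of_comp as = foldr (\<lambda>a \<tau>. id_perm a \<ominus> \<tau>) as []"

text \<open>Meaningful for \<open>\<pi> \<in> S_av n\<close>, where the composition exists and is unique.\<close>

definition \<kappa> :: "nat list \<Rightarrow> nat list" where
  "\<kappa> \<pi> = (THE as. is_composition (length \<pi>) as \<and> \<pi> = perm_of_comp as)"

definition balanced :: "nat list \<Rightarrow> bool" where
  "balanced \<pi> \<longleftrightarrow> (\<exists>N. \<pi> \<in> C_av (2 * N) \<and>
     (\<exists>j. 1 \<le> j \<and> j < length (\<kappa> \<pi>) \<and> sum_list (take j (\<kappa> \<pi>)) = N))"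

definition dom_A :: "nat list set" where
  "dom_A = {\<pi> \<in> (\<Union>n\<in>{1..}. C_av n). 2 \<le> length (\<kappa> \<pi>) \<and> last (\<kappa> \<pi>) < hd (\<kappa> \<pi>)}"

definition dom_B :: "nat list set" where
  "dom_B = {\<pi> \<in> (\<Union>n\<in>{1..}. C_av n). 2 \<le> length (\<kappa> \<pi>)}"

definition dom_C :: "nat list set" where
  "dom_C = (\<Union>n\<in>{1..}. C_av n)"

text \<open>On \<^term>\<open>dom_A\<close> the subtraction is not truncated, since the last part is smaller than the
  first.\<close>

definition \<Phi>\<^sub>A :: "nat list \<Rightarrow> nat list" where
  "\<Phi>\<^sub>A \<pi> = (let as = \<kappa> \<pi> in
     perm_of_comp ((2 * hd as - last as) # butlast (tl as) @ [hd as]))"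

definition \<Phi>\<^sub>B :: "nat list \<Rightarrow> nat list" where
  "\<Phi>\<^sub>B \<pi> = (let as = \<kappa> \<pi> in
     perm_of_comp ((as ! 0 + 2 * as ! 1) # drop 2 as @ [as ! 1]))"

definition \<Phi>\<^sub>C :: "nat list \<Rightarrow> nat list" where
  "\<Phi>\<^sub>C \<pi> = (let as = \<kappa> \<pi> in
     perm_of_comp ((2 * hd as) # tl as @ [hd as]))"

end

theory Submission
  imports Defs
begin

text \<open>A permutation with composition $(a_1,\dots,a_k)$ cuts $[n]$ into intervals of lengths
  $a_1,\dots,a_k$ and puts them back in reverse order, each by a translation. Changing the parts
  at the two ends by suitable amounts leaves the translations of the parts in between unchanged up
  to a common shift of the points. After that shift, each of the three maps therefore only
  \<^emph>\<open>subdivides\<close> the cycle: there is an embedding $h$ of the old points into the new ones such that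
  the step $x\mapsto\pi(x)$ becomes a path $h(x)\to\dots\to h(\pi(x))$ of length one or three, and
  the interior points of these paths are exactly the new points. Subdividing the edges of a single
  cycle gives a single cycle (\<open>cyclic_on_subdivision\<close>).

  For $\Phi_B$ and $\Phi_C$ the embedding is the shift by $c=a_2$, respectively $c=a_1$. The points
  of one old interval of length $c$ (the second, respectively the first) run through the new last
  interval $(n+c,n+2c]$, then through $[1,c]$, and then reach the image of their old successor
  (\<open>cyclic_on_shift_insert\<close>). For $\Phi_A$, with $d=a_1-a_k$, the points $1,\dots,d$ make such a
  detour; the embedding is the shift by $d$ before the last interval and by $2d$ on it, because the
  detour inserts $d$ points on the left and another $d$ points just before the last interval
  (\<open>C_av_enlarge_end_parts\<close>).

  What makes this computation available is that \<^term>\<open>\<kappa>\<close> is a genuine inverse of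
  \<^term>\<open>perm_of_comp\<close>: existence comes from splitting off the entries up to the maximum
  (\<open>S_av_is_perm_of_comp\<close>), uniqueness from reading off the first entry
  (\<open>perm_of_comp_inject\<close>). Injectivity of the three maps is then visible on compositions, since the
  last part of the new composition reveals $a_1$, $a_2$ or $a_1$ respectively, and the rest
  follows. Balance is the existence of a proper prefix of parts adding up to half of the total. Apart from
  the cut after $a_1$, which $\Phi_B$ destroys, every interior cut stays one, and each map adds half
  of the increase in $n$ to the parts before it.\<close>

section \<open>Pattern avoidance\<close>

lemma order_isomorphic_triple:
  "order_isomorphic xs [a,b,c] \<longleftrightarrow> (\<exists>x y z. xs = [x,y,z] \<and>
     (x < y \<longleftrightarrow> a < b) \<and> (y < x \<longleftrightarrow> b < a) \<and> (x < z \<longleftrightarrow> a < c) \<and>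
     (z < x \<longleftrightarrow> c < a) \<and> (y < z \<longleftrightarrow> b < c) \<and> (z < y \<longleftrightarrow> c < b))"
proof -
  have all3: "(\<forall>i<3. P i) \<longleftrightarrow> P 0 \<and> P 1 \<and> P 2" for P :: "nat \<Rightarrow> bool"
    by (simp add: All_less_Suc2 numeral_3_eq_3 numeral_2_eq_2)
  have len: "length [u,v,w] = 3" for u v w :: nat
    by simp
  have "order_isomorphic [x,y,z] [a,b,c] \<longleftrightarrow>
     (x < y \<longleftrightarrow> a < b) \<and> (y < x \<longleftrightarrow> b < a) \<and> (x < z \<longleftrightarrow> a < c) \<and>
     (z < x \<longleftrightarrow> c < a) \<and> (y < z \<longleftrightarrow> b < c) \<and> (z < y \<longleftrightarrow> c < b)" for x y z
    unfolding order_isomorphic_def len all3 by auto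
  moreover have "\<exists>x y z. xs = [x,y,z]" if "order_isomorphic xs [a,b,c]"
    using that by (auto simp: order_isomorphic_def length_Suc_conv)
  ultimately show ?thesis
    by (cases "\<exists>x y z. xs = [x,y,z]") auto
qed

lemma avoids_132_iff:
  "avoids \<pi> [1,3,2] \<longleftrightarrow> (\<forall>x y z. subseq [x,y,z] \<pi> \<longrightarrow> \<not> (x < z \<and> z < y))"
  unfolding avoids_def order_isomorphic_triple by (auto; metis less_asym less_trans)

lemma avoids_213_iff:
  "avoids \<pi> [2,1,3] \<longleftrightarrow> (\<forall>x y z. subseq [x,y,z] \<pi> \<longrightarrow> \<not> (y < x \<and> x < z))"
  unfolding avoids_def order_isomorphic_triple by (auto; metis less_asym less_trans)

lemma subseq_set_subset: "subseq xs ys \<Longrightarrow> set xs \<subseteq> set ys"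
  by (auto simp: subseq_conv_nths dest: in_set_nthsD)

lemma subseq_distinct: "subseq xs ys \<Longrightarrow> distinct ys \<Longrightarrow> distinct xs"
  by (auto simp: subseq_conv_nths)

text \<open>Pattern conditions speak of subsequences; this translates between them and sortedness, in
  particular turning the absence of a descent into sortedness.\<close>

lemma sorted_wrt_iff_subseq: "sorted_wrt R xs \<longleftrightarrow> (\<forall>x y. subseq [x,y] xs \<longrightarrow> R x y)"
proof (induction xs)
  case Nil
  then show ?case by simp
next
  case (Cons a xs)
  have "subseq [x,y] (a # xs) \<longleftrightarrow> x = a \<and> y \<in> set xs \<or> subseq [x,y] xs" for x y
    by (auto simp: subseq_Cons2_iff subseq_singleton_left dest: subseq_Cons')
  then show ?case
    using Cons.IH by auto
qed

lemma avoids_subseq: "avoids \<pi> p \<Longrightarrow> subseq \<rho> \<pi> \<Longrightarrow> avoids \<rho> p"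
  unfolding avoids_def by (meson subseq_order.order_trans)

text \<open>A triple that straddles the two halves has its first entry in the left one and its last entry
  in the right one. Both patterns 132 and 213 have a smaller first than last entry, so no occurrence
  of them can straddle a decreasing cut.\<close>

lemma subseq3_append_cases:
  assumes "subseq [x,y,z] (xs @ ys)"
  obtains "x \<in> set xs" "z \<in> set ys" | "subseq [x,y,z] xs" | "subseq [x,y,z] ys"
proof -
  obtain us vs where uv: "[x,y,z] = us @ vs" "subseq us xs" "subseq vs ys"
    using assms by (auto simp: subseq_append_iff)
  have sub: "set us \<subseteq> set xs" "set vs \<subseteq> set ys"
    using uv(2,3) subseq_set_subset by blast+
  show ?thesis
  proof (cases us)
    case Nil
    then show ?thesis using uv that(3) by simp
  next
    case (Cons u us')
    then have x: "x \<in> set xs" using uv(1) sub by auto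
    show ?thesis
    proof (cases vs rule: rev_cases)
      case Nil
      then show ?thesis using uv that(2) by simp
    next
      case (snoc vs' v)
      then have "[x,y,z] = (us @ vs') @ [v]" using uv(1) by simp
      then have "z = v" by (metis last.simps last_snoc list.distinct(1))
      then show ?thesis using x snoc sub that(1) by auto
    qed
  qed
qed

lemma avoids_append:
  assumes "sorted_wrt (<) xs" "\<And>x y. x \<in> set xs \<Longrightarrow> y \<in> set ys \<Longrightarrow> y < x"
  shows "avoids ys [1,3,2] \<Longrightarrow> avoids (xs @ ys) [1,3,2]"
    and "avoids ys [2,1,3] \<Longrightarrow> avoids (xs @ ys) [2,1,3]"
proof -
  have xs: "x < y \<and> y < z" if "subseq [x,y,z] xs" for x y z
  proof -
    have "subseq [x,y] [x,y,z]" "subseq [y,z] [x,y,z]" by auto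
    then show ?thesis
      using assms(1) that unfolding sorted_wrt_iff_subseq by (meson subseq_order.trans)
  qed
  show "avoids ys [1,3,2] \<Longrightarrow> avoids (xs @ ys) [1,3,2]"
    unfolding avoids_132_iff by (metis assms(2) less_asym' subseq3_append_cases xs)
  show "avoids ys [2,1,3] \<Longrightarrow> avoids (xs @ ys) [2,1,3]"
    unfolding avoids_213_iff by (metis assms(2) less_asym' subseq3_append_cases xs)
qed

section \<open>Permutations of a composition\<close>

lemma length_perm_of_comp [simp]: "length (perm_of_comp as) = sum_list as"
  by (induction as) (simp_all add: perm_of_comp_def skew_sum_def id_perm_def)

lemma perm_of_comp_Nil [simp]: "perm_of_comp [] = []"
  by (simp add: perm_of_comp_def)

lemma map_add_upt_shift: "map (\<lambda>x. x + c) [i..<j] = [i + c..<j + (c::nat)]"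
  by (induction j) auto

text \<open>In this recursion only the new leading block is shifted, and the remaining permutation appears
  verbatim; this suits proofs by induction better than the nested skew sums.\<close>

lemma perm_of_comp_Cons:
  "perm_of_comp (a # as) = [Suc (sum_list as)..<Suc (sum_list as + a)] @ perm_of_comp as"
proof -
  have "perm_of_comp (a # as) = map (\<lambda>x. x + sum_list as) [1..<Suc a] @ perm_of_comp as"
    using length_perm_of_comp[of as]
    by (simp add: perm_of_comp_def skew_sum_def id_perm_def del: length_perm_of_comp)
  then show ?thesis
    by (simp add: map_add_upt_shift add.commute del: upt_Suc)
qed

lemma perm_of_comp_append:
  "perm_of_comp (as @ bs) = map (\<lambda>x. x + sum_list bs) (perm_of_comp as) @ perm_of_comp bs"
  by (induction as) (simp_all add: perm_of_comp_Cons map_add_upt_shift add_ac del: upt_Suc)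

lemma set_perm_of_comp [simp]: "set (perm_of_comp as) = {1..sum_list as}"
  by (induction as) (auto simp: perm_of_comp_Cons simp del: upt_Suc)

lemma distinct_perm_of_comp [simp]: "distinct (perm_of_comp as)"
  by (rule card_distinct) simp

lemma perm_of_comp_in_S_av: "perm_of_comp as \<in> S_av (sum_list as)"
proof -
  have "avoids (perm_of_comp as) [1,3,2] \<and> avoids (perm_of_comp as) [2,1,3]"
  proof (induction as)
    case Nil
    then show ?case unfolding avoids_132_iff avoids_213_iff by simp
  next
    case (Cons a as)
    then show ?case
      unfolding perm_of_comp_Cons
      by (intro conjI avoids_append) (auto simp del: upt_Suc)
  qed
  then show ?thesis
    by (simp add: S_av_def permutations_of_set_def)
qed

text \<open>Cut the permutation after its maximum $n$. Avoiding 132 makes every entry before $n$ larger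
  than every entry after it, and avoiding 213 makes the entries before $n$ increase. So the initial
  segment is an increasing run of the largest values, that is, the first block, and the rest is a
  shorter permutation of the same kind.\<close>

lemma S_av_is_perm_of_comp:
  "\<pi> \<in> S_av n \<Longrightarrow> \<exists>as. is_composition n as \<and> \<pi> = perm_of_comp as"
proof (induction n arbitrary: \<pi> rule: less_induct)
  case (less n)
  have \<pi>: "set \<pi> = {1..n}" "distinct \<pi>"
    and av: "avoids \<pi> [1,3,2]" "avoids \<pi> [2,1,3]"
    using less.prems by (auto simp: S_av_def permutations_of_set_def)
  show ?case
  proof (cases "n = 0")
    case True
    then have "is_composition n [] \<and> \<pi> = perm_of_comp []"
      using \<pi> by (simp add: is_composition_def)
    then show ?thesis by blast
  next
    case False
    then obtain xs ys where split: "\<pi> = xs @ n # ys"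
      using \<pi>(1) by (metis atLeastAtMost_iff le_refl less_one not_less split_list)
    have le: "v < n" if "v \<in> set xs \<union> set ys" for v
      using that \<pi> split by (metis Un_iff atLeastAtMost_iff distinct_append distinct.simps(2)
          disjoint_iff le_neq_implies_less list.set_intros set_append list.set_intros(2))
    have above: "y < x" if "x \<in> set xs" "y \<in> set ys" for x y
    proof -
      have "subseq ([x] @ [n] @ [y]) (xs @ [n] @ ys)"
        by (intro list_emb_append_mono) (use that in \<open>auto simp: subseq_singleton_left\<close>)
      then have "\<not> (x < y \<and> y < n)"
        using av(1) split unfolding avoids_132_iff by simp
      moreover have "x \<noteq> y"
        using \<pi>(2) split that by auto
      ultimately show ?thesis
        using le that by (meson UnI2 linorder_neqE_nat)
    qed
    have "sorted_wrt (<) xs"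
      unfolding sorted_wrt_iff_subseq
    proof (intro allI impI)
      fix x y assume xy: "subseq [x,y] xs"
      have "subseq ([x,y] @ [n]) (xs @ n # ys)"
        by (intro list_emb_append_mono) (use xy in \<open>auto simp: subseq_singleton_left\<close>)
      then have "\<not> (y < x \<and> x < n)"
        using av(2) split unfolding avoids_213_iff by simp
      moreover have "distinct [x,y]"
        using xy \<pi>(2) split by (intro subseq_distinct[OF xy]) simp
      moreover have "x < n"
        using subseq_set_subset[OF xy] le by simp
      ultimately show "x < y"
        by auto
    qed
    then have sorted: "sorted_wrt (<) (xs @ [n])"
      using le by (auto simp: sorted_wrt_append)
    define m where "m = length ys"
    \<comment> \<open>All entries outside \<open>ys\<close> exceed those in \<open>ys\<close>, so \<open>set ys\<close> is an initial segment.\<close>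
    have ys: "set ys = {1..m}"
    proof (cases "ys = []")
      case False
      define M where "M = Max (set ys)"
      have M: "M \<in> set ys" "\<And>y. y \<in> set ys \<Longrightarrow> y \<le> M"
        using False by (auto simp: M_def)
      have down: "v \<in> set ys" if "1 \<le> v" "v \<le> M" for v
      proof -
        have "M < n" using le M(1) by simp
        then have "v \<in> set \<pi>" "v \<noteq> n" using that \<pi>(1) by auto
        then show ?thesis
          using split above[OF _ M(1), of v] that by auto
      qed
      have "1 \<le> v" if "v \<in> set ys" for v
        using that \<pi>(1) split by auto
      then have "set ys = {1..M}"
        using down M(2) by (intro set_eqI) (metis atLeastAtMost_iff)
      moreover have "card (set ys) = m"
        using \<pi>(2) split by (simp add: m_def distinct_card)
      ultimately show ?thesis by simp
    qed (simp add: m_def)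
    have mn: "m < n"
      using split \<pi> distinct_card[OF \<pi>(2)] by (simp add: m_def)
    have "set (xs @ [n]) = set \<pi> - set ys"
      using split \<pi>(2) by auto
    also have "\<dots> = set [Suc m..<Suc n]"
      using \<pi>(1) ys by (auto simp del: upt_Suc)
    finally have xs: "xs @ [n] = [Suc m..<Suc n]"
      using sorted by (intro strict_sorted_equal) (auto simp del: upt_Suc)
    have "subseq ys \<pi>"
      using split list_emb_append2[of "(=)" ys ys "xs @ [n]"] by simp
    then have "ys \<in> S_av m"
      using av \<pi>(2) split ys avoids_subseq by (auto simp: S_av_def permutations_of_set_def)
    then obtain as where as: "is_composition m as" "ys = perm_of_comp as"
      using less.IH mn by blast
    have "\<pi> = perm_of_comp ((n - m) # as)"
      using split xs as mn by (simp add: perm_of_comp_Cons is_composition_def del: upt_Suc)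
    moreover have "is_composition n ((n - m) # as)"
      using as(1) mn by (auto simp: is_composition_def)
    ultimately show ?thesis by blast
  qed
qed

text \<open>The first entry exceeds by one the sum of all parts but the first. Together with the length it
  determines the first part.\<close>

lemma perm_of_comp_inject:
  assumes "\<forall>a\<in>set as. 0 < a" "\<forall>b\<in>set bs. 0 < b" "perm_of_comp as = perm_of_comp bs"
  shows "as = bs"
  using assms
proof (induction as arbitrary: bs)
  case Nil
  then have "sum_list bs = 0"
    by (metis length_perm_of_comp sum_list.Nil)
  with Nil show ?case
    by (cases bs) auto
next
  case (Cons a as)
  have n: "a + sum_list as = sum_list bs"
    using Cons.prems(3) by (metis length_perm_of_comp sum_list.Cons)
  then obtain b bs' where bs: "bs = b # bs'"
    using Cons.prems(1) by (cases bs) auto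
  have pos: "0 < a" "0 < b"
    using Cons.prems bs by auto
  have "hd (perm_of_comp (a # as)) = Suc (sum_list as)" "hd (perm_of_comp bs) = Suc (sum_list bs')"
    using pos by (simp_all add: bs perm_of_comp_Cons upt_conv_Cons del: upt_Suc)
  then have m: "sum_list as = sum_list bs'"
    using Cons.prems(3) by simp
  then have ab: "a = b"
    using n bs by simp
  have "perm_of_comp as = perm_of_comp bs'"
    using Cons.prems(3) unfolding bs perm_of_comp_Cons m ab by blast
  then show ?case
    using Cons.IH[of bs'] Cons.prems(1,2) bs ab by simp
qed

lemma \<kappa>_perm_of_comp:
  assumes "\<forall>a\<in>set as. 0 < a"
  shows "\<kappa> (perm_of_comp as) = as"
  unfolding \<kappa>_def
proof (rule the_equality)
  show "is_composition (length (perm_of_comp as)) as \<and> perm_of_comp as = perm_of_comp as"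
    using assms by (simp add: is_composition_def)
next
  fix bs assume "is_composition (length (perm_of_comp as)) bs \<and> perm_of_comp as = perm_of_comp bs"
  then show "bs = as"
    using assms perm_of_comp_inject[of as bs] unfolding is_composition_def by blast
qed

lemma C_av_cases:
  assumes "\<pi> \<in> C_av n"
  obtains as where "\<forall>a\<in>set as. 0 < a" "sum_list as = n" "\<pi> = perm_of_comp as" "\<kappa> \<pi> = as"
proof -
  obtain as where "is_composition n as" "\<pi> = perm_of_comp as"
    using assms S_av_is_perm_of_comp unfolding C_av_def by blast
  then show ?thesis
    using that[of as] \<kappa>_perm_of_comp[of as] by (simp add: is_composition_def)
qed

lemma perm_of_comp_in_C_av_iff:
  "perm_of_comp as \<in> C_av n \<longleftrightarrow>
     sum_list as = n \<and> cyclic_on (perm_fun (perm_of_comp as)) {1..n}"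
proof -
  have "sum_list as = n" if "perm_of_comp as \<in> S_av n"
  proof -
    have "perm_of_comp as \<in> permutations_of_set {1..n}"
      using that unfolding S_av_def by blast
    from length_finite_permutations_of_set[OF this] show ?thesis
      by simp
  qed
  then show ?thesis
    unfolding C_av_def mem_Collect_eq by (metis perm_of_comp_in_S_av)
qed

text \<open>Doubling the partial sum avoids naming the half $N$.\<close>

lemma balanced_perm_of_comp_iff:
  assumes "\<forall>a\<in>set as. 0 < a"
  shows "balanced (perm_of_comp as) \<longleftrightarrow> perm_of_comp as \<in> C_av (sum_list as) \<and>
    (\<exists>j. 1 \<le> j \<and> j < length as \<and> 2 * sum_list (take j as) = sum_list as)"
  unfolding balanced_def \<kappa>_perm_of_comp[OF assms]
proof
  assume "\<exists>N. perm_of_comp as \<in> C_av (2 * N) \<and>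
    (\<exists>j. 1 \<le> j \<and> j < length as \<and> sum_list (take j as) = N)"
  then show "perm_of_comp as \<in> C_av (sum_list as) \<and>
    (\<exists>j. 1 \<le> j \<and> j < length as \<and> 2 * sum_list (take j as) = sum_list as)"
    unfolding perm_of_comp_in_C_av_iff by auto
next
  assume *: "perm_of_comp as \<in> C_av (sum_list as) \<and>
    (\<exists>j. 1 \<le> j \<and> j < length as \<and> 2 * sum_list (take j as) = sum_list as)"
  then obtain j where "1 \<le> j" "j < length as" "2 * sum_list (take j as) = sum_list as"
    by blast
  with * show "\<exists>N. perm_of_comp as \<in> C_av (2 * N) \<and>
    (\<exists>j. 1 \<le> j \<and> j < length as \<and> sum_list (take j as) = N)"
    by (intro exI[of _ "sum_list (take j as)"]) auto
qed

section \<open>The action on points\<close>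

lemma perm_fun_perm_of_comp_range:
  assumes "x \<in> {1..sum_list as}"
  shows "perm_fun (perm_of_comp as) x \<in> {1..sum_list as}"
proof -
  have "perm_fun (perm_of_comp as) x = perm_of_comp as ! (x - 1)"
    using assms by (simp add: perm_fun_def)
  also have "\<dots> \<in> set (perm_of_comp as)"
    using assms by (intro nth_mem) auto
  finally show ?thesis by simp
qed

lemma perm_fun_perm_of_comp_append:
  "1 \<le> x \<Longrightarrow> x \<le> sum_list as \<Longrightarrow>
     perm_fun (perm_of_comp (as @ bs)) x = perm_fun (perm_of_comp as) x + sum_list bs"
  "sum_list as < x \<Longrightarrow> x \<le> sum_list as + sum_list bs \<Longrightarrow>
     perm_fun (perm_of_comp (as @ bs)) x = perm_fun (perm_of_comp bs) (x - sum_list as)"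
  by (auto simp: perm_fun_def perm_of_comp_append nth_append)

lemma perm_fun_perm_of_comp_single:
  "1 \<le> x \<Longrightarrow> x \<le> a \<Longrightarrow> perm_fun (perm_of_comp [a]) x = x"
  by (auto simp: perm_fun_def perm_of_comp_Cons simp del: upt_Suc)

lemma perm_fun_perm_of_comp_Cons:
  "1 \<le> x \<Longrightarrow> x \<le> a \<Longrightarrow> perm_fun (perm_of_comp (a # as)) x = x + sum_list as"
  "a < x \<Longrightarrow> x \<le> a + sum_list as \<Longrightarrow>
     perm_fun (perm_of_comp (a # as)) x = perm_fun (perm_of_comp as) (x - a)"
  using perm_fun_perm_of_comp_append[where x = x and as = "[a]" and bs = as]
  by (simp_all add: perm_fun_perm_of_comp_single)

text \<open>All three maps produce compositions of the form \<open>p # r @ [q]\<close>; the middle part \<open>r\<close> always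
  stems from the given permutation.\<close>

lemma perm_fun_perm_of_comp_Cons_snoc:
  "1 \<le> x \<Longrightarrow> x \<le> p \<Longrightarrow> perm_fun (perm_of_comp (p # r @ [q])) x = x + sum_list r + q"
  "p < x \<Longrightarrow> x \<le> p + sum_list r \<Longrightarrow>
     perm_fun (perm_of_comp (p # r @ [q])) x = perm_fun (perm_of_comp r) (x - p) + q"
  "p + sum_list r < x \<Longrightarrow> x \<le> p + sum_list r + q \<Longrightarrow>
     perm_fun (perm_of_comp (p # r @ [q])) x = x - (p + sum_list r)"
  by (auto simp: perm_fun_perm_of_comp_Cons perm_fun_perm_of_comp_append
      perm_fun_perm_of_comp_single)

section \<open>Subdividing a cycle\<close>

text \<open>The old cycle becomes a closed walk through the points $h(x)$, which visits all of \<open>A\<close>. Since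
  \<^const>\<open>orbit\<close> contains only proper iterates, reaching a point from itself is part of the claim.\<close>

lemma cyclic_on_subdivision:
  assumes "cyclic_on g B"
    and maps: "\<And>y. y \<in> A \<Longrightarrow> f y \<in> A"
    and emb: "\<And>x. x \<in> B \<Longrightarrow> h x \<in> A"
    and step: "\<And>x. x \<in> B \<Longrightarrow> h (g x) \<in> orbit f (h x)"
    and cover: "\<And>y. y \<in> A \<Longrightarrow> \<exists>x\<in>B. y = h x \<or> y \<in> orbit f (h x)"
  shows "cyclic_on f A"
proof -
  obtain s where s: "s \<in> B" "B = orbit g s"
    using assms(1) by (auto simp: cyclic_on_def)
  have reach: "h x \<in> orbit f (h s)" if "x \<in> B" for x
  proof -
    have "x \<in> orbit g s" using that s by simp
    then show ?thesis
    proof induction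
      case base
      then show ?case using step s by simp
    next
      case (step x)
      then show ?case using assms(4)[of x] s(2) orbit_trans by metis
    qed
  qed
  have "A \<subseteq> orbit f (h s)"
  proof
    fix y assume "y \<in> A"
    then obtain x where "x \<in> B" "y = h x \<or> y \<in> orbit f (h x)"
      using cover by blast
    then show "y \<in> orbit f (h s)"
      using reach[of x] orbit_trans[of y f "h x" "h s"] by auto
  qed
  moreover have "y \<in> A" if "y \<in> orbit f (h s)" for y
    using that by induction (use maps emb s(1) in auto)
  ultimately show ?thesis
    using emb s(1) unfolding cyclic_on_def by blast
qed

lemma orbit_iterates: "f (f (f x)) \<in> orbit f x" "f (f x) \<in> orbit f x"
  by (auto intro: orbit.intros)

text \<open>Put $d=a-c$ and let \<open>f\<close> be the new permutation, \<open>g\<close> the old one. A point $x\le d$ takes the path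
  $x+d\to x+d+R+a\to x\to x+R+a$, which ends at the image of \<open>g x\<close> because \<open>g\<close> sends the points up
  to $d$ to the left of the old last interval. All other old steps remain single steps.\<close>

lemma C_av_enlarge_end_parts:
  assumes "perm_of_comp (a # r @ [c]) \<in> C_av n" "c < a"
  shows "perm_of_comp ((2 * a - c) # r @ [a]) \<in> C_av (n + 2 * (a - c))"
proof -
  define d R where "d = a - c" and "R = sum_list r"
  have a: "a = c + d" "0 < d" using assms(2) by (auto simp: d_def)
  define g f where "g = perm_fun (perm_of_comp (a # r @ [c]))"
    and "f = perm_fun (perm_of_comp ((a + d) # r @ [a]))"
  have n: "n = a + R + c" and cyc: "cyclic_on g {1..n}"
    using assms(1) by (auto simp: perm_of_comp_in_C_av_iff g_def R_def)
  note g = perm_fun_perm_of_comp_Cons_snoc[where p = a and r = r and q = c, folded g_def R_def]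
  note f = perm_fun_perm_of_comp_Cons_snoc[where p = "a + d" and r = r and q = a, folded f_def R_def]
  note r = perm_fun_perm_of_comp_range[where as = r, folded R_def]
  define h where "h x = (if x \<le> a + R then x + d else x + 2 * d)" for x
  have detour: "f (h x) = x + d + R + a" "f (f (h x)) = x" "f (f (f (h x))) = h (g x)"
    if "1 \<le> x" "x \<le> d" for x
  proof -
    show 1: "f (h x) = x + d + R + a"
      using that a by (simp add: h_def f)
    show 2: "f (f (h x)) = x"
      unfolding 1 using that a by (simp add: f)
    show "f (f (f (h x))) = h (g x)"
      unfolding 2 using that a by (simp add: f g h_def)
  qed
  have direct: "f (h x) = h (g x)" if x: "d < x" "x \<le> n" for x
  proof -
    consider "x \<le> a" | "a < x" "x \<le> a + R" | "a + R < x" by linarith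
    then show ?thesis
    proof cases
      case 1
      then show ?thesis using x a by (simp add: h_def f g)
    next
      case 2
      then have "x - a \<in> {1..R}"
        by simp linarith
      then have "perm_fun (perm_of_comp r) (x - a) \<le> R"
        using r[of "x - a"] by simp
      with 2 show ?thesis using x a by (simp add: h_def f g)
    next
      case 3
      then show ?thesis using x a n by (simp add: h_def f g)
    qed
  qed
  have "cyclic_on f {1..n + 2 * d}"
  proof (rule cyclic_on_subdivision[OF cyc])
    show "f y \<in> {1..n + 2 * d}" if "y \<in> {1..n + 2 * d}" for y
      using perm_fun_perm_of_comp_range[of y "(a + d) # r @ [a]"] that a n
      by (simp add: f_def R_def)
    show "h x \<in> {1..n + 2 * d}" if "x \<in> {1..n}" for x
      using that by (auto simp: h_def)
    show "h (g x) \<in> orbit f (h x)" if "x \<in> {1..n}" for x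
      using that detour(3)[of x] direct[of x] orbit_iterates[of f "h x"] orbit.base[of f "h x"]
      by (cases "x \<le> d") auto
    show "\<exists>x\<in>{1..n}. y = h x \<or> y \<in> orbit f (h x)" if y: "y \<in> {1..n + 2 * d}" for y
    proof -
      consider "y \<le> d" | "d < y" "y \<le> a + R + d"
        | "a + R + d < y" "y \<le> a + R + 2 * d" | "a + R + 2 * d < y"
        by linarith
      then show ?thesis
      proof cases
        case 1
        then have "y \<in> {1..n}" "y \<in> orbit f (h y)"
          using y a n detour(2)[of y] orbit_iterates(2)[of f "h y"] by auto
        then show ?thesis by blast
      next
        case 2
        then have "y = h (y - d)" "y - d \<in> {1..n}"
          using n by (auto simp: h_def)
        then show ?thesis by blast
      next
        case 3
        define x where "x = y - (a + R + d)"
        have "x \<in> {1..n}" "y = f (h x)"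
          using 3 a n detour(1)[of x] by (auto simp: x_def)
        then show ?thesis using orbit.base by metis
      next
        case 4
        then have "y = h (y - 2 * d)" "y - 2 * d \<in> {1..n}"
          using y by (auto simp: h_def)
        then show ?thesis by blast
      qed
    qed
  qed
  moreover have "2 * a - c = a + d" "n + 2 * (a - c) = n + 2 * d"
    using a by auto
  moreover have "sum_list ((a + d) # r @ [a]) = n + 2 * d"
    using n a by (simp add: R_def)
  ultimately show ?thesis
    unfolding perm_of_comp_in_C_av_iff f_def by metis
qed

text \<open>The common shape of $\Phi_B$ and $\Phi_C$: the old points are shifted by \<open>c\<close>, and the points of
  the interval $(e,e+c]$ make a detour through the \<open>c\<close> new points at the right end and then
  through those at the left end.\<close>

lemma cyclic_on_shift_insert:
  fixes f g :: "nat \<Rightarrow> nat"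
  assumes "cyclic_on g {1..n}"
    and maps: "\<And>y. y \<in> {1..n + 2 * c} \<Longrightarrow> f y \<in> {1..n + 2 * c}"
    and "e + c \<le> n"
    and detour: "\<And>i. 1 \<le> i \<Longrightarrow> i \<le> c \<Longrightarrow>
      f (e + i + c) = n + c + i \<and> f (n + c + i) = i \<and> f i = g (e + i) + c"
    and direct: "\<And>x. x \<in> {1..n} - {e + 1..e + c} \<Longrightarrow> f (x + c) = g x + c"
  shows "cyclic_on f {1..n + 2 * c}"
proof (rule cyclic_on_subdivision[OF assms(1) maps, where h = "\<lambda>x. x + c"])
  have path: "f (e + i + c) = n + c + i" "f (f (e + i + c)) = i"
    "f (f (f (e + i + c))) = g (e + i) + c" if "1 \<le> i" "i \<le> c" for i
    using detour[OF that] by auto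
  show "x + c \<in> {1..n + 2 * c}" if "x \<in> {1..n}" for x
    using that by auto
  show "g x + c \<in> orbit f (x + c)" if x: "x \<in> {1..n}" for x
  proof (cases "x \<in> {e + 1..e + c}")
    case True
    then have "f (f (f (x + c))) = g x + c"
      using path(3)[of "x - e"] by auto
    then show ?thesis using orbit_iterates(1)[of f "x + c"] by simp
  next
    case False
    then show ?thesis using direct[of x] x orbit.base[of f "x + c"] by simp
  qed
  show "\<exists>x\<in>{1..n}. y = x + c \<or> y \<in> orbit f (x + c)" if y: "y \<in> {1..n + 2 * c}" for y
  proof -
    consider "y \<le> c" | "c < y" "y \<le> n + c" | "n + c < y" by linarith
    then show ?thesis
    proof cases
      case 1
      then have "e + y \<in> {1..n}" "y \<in> orbit f (e + y + c)"
        using y assms(3) path(2)[of y] orbit_iterates(2)[of f "e + y + c"] by auto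
      then show ?thesis by blast
    next
      case 2
      then have "y = (y - c) + c" "y - c \<in> {1..n}" by auto
      then show ?thesis by blast
    next
      case 3
      define i where "i = y - (n + c)"
      have "e + i \<in> {1..n}" "y = f (e + i + c)"
        using 3 y assms(3) path(1)[of i] by (auto simp: i_def)
      then show ?thesis using orbit.base by metis
    qed
  qed
qed

text \<open>The detour belongs to the old second interval $(a,a+b]$: after the shift by \<open>b\<close> it is the end of
  the enlarged first interval, which is sent to the new last interval.\<close>

lemma C_av_move_second_part:
  assumes "perm_of_comp (a # b # r) \<in> C_av n"
  shows "perm_of_comp ((a + 2 * b) # r @ [b]) \<in> C_av (n + 2 * b)"
proof -
  define R where "R = sum_list r"
  define g f where "g = perm_fun (perm_of_comp (a # b # r))"
    and "f = perm_fun (perm_of_comp ((a + 2 * b) # r @ [b]))"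
  have n: "n = a + b + R" and cyc: "cyclic_on g {1..n}"
    using assms by (auto simp: perm_of_comp_in_C_av_iff g_def R_def)
  have g: "1 \<le> x \<Longrightarrow> x \<le> a \<Longrightarrow> g x = x + b + R"
    "a < x \<Longrightarrow> x \<le> a + b \<Longrightarrow> g x = x - a + R"
    "a + b < x \<Longrightarrow> x \<le> n \<Longrightarrow> g x = perm_fun (perm_of_comp r) (x - (a + b))" for x
    by (auto simp: g_def R_def n perm_fun_perm_of_comp_Cons)
  note f = perm_fun_perm_of_comp_Cons_snoc[where p = "a + 2 * b" and r = r and q = b, folded f_def R_def]
  have "cyclic_on f {1..n + 2 * b}"
  proof (rule cyclic_on_shift_insert[OF cyc, where e = a])
    show "f y \<in> {1..n + 2 * b}" if "y \<in> {1..n + 2 * b}" for y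
      using perm_fun_perm_of_comp_range[of y "(a + 2 * b) # r @ [b]"] that n
      by (simp add: f_def R_def algebra_simps)
    show "f (x + b) = g x + b" if "x \<in> {1..n} - {a + 1..a + b}" for x
    proof (cases "x \<le> a")
      case True
      then show ?thesis using that by (simp add: f g)
    next
      case False
      then show ?thesis using that n by (auto simp: f g add.commute)
    qed
  qed (use n in \<open>auto simp: f g\<close>)
  moreover have "sum_list ((a + 2 * b) # r @ [b]) = n + 2 * b"
    using n by (simp add: R_def)
  ultimately show ?thesis
    unfolding perm_of_comp_in_C_av_iff f_def by metis
qed

text \<open>Here the detour belongs to the old first interval, which becomes the second half of the doubled
  one. All old points outside it lie in the middle intervals.\<close>

lemma C_av_double_first_part:
  assumes "perm_of_comp (a # r) \<in> C_av n"
  shows "perm_of_comp ((2 * a) # r @ [a]) \<in> C_av (n + 2 * a)"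
proof -
  define R where "R = sum_list r"
  define g f where "g = perm_fun (perm_of_comp (a # r))"
    and "f = perm_fun (perm_of_comp ((2 * a) # r @ [a]))"
  have n: "n = a + R" and cyc: "cyclic_on g {1..n}"
    using assms by (auto simp: perm_of_comp_in_C_av_iff g_def R_def)
  note g = perm_fun_perm_of_comp_Cons[where a = a and as = r, folded g_def R_def]
  note f = perm_fun_perm_of_comp_Cons_snoc[where p = "2 * a" and r = r and q = a, folded f_def R_def]
  have "cyclic_on f {1..n + 2 * a}"
  proof (rule cyclic_on_shift_insert[OF cyc, where e = 0])
    show "f y \<in> {1..n + 2 * a}" if "y \<in> {1..n + 2 * a}" for y
      using perm_fun_perm_of_comp_range[of y "(2 * a) # r @ [a]"] that n
      by (simp add: f_def R_def algebra_simps)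
  qed (use n in \<open>auto simp: f g\<close>)
  moreover have "sum_list ((2 * a) # r @ [a]) = n + 2 * a"
    using n by (simp add: R_def)
  ultimately show ?thesis
    unfolding perm_of_comp_in_C_av_iff f_def by metis
qed

section \<open>The three maps\<close>

lemma dom_A_cases:
  assumes "\<pi> \<in> dom_A"
  obtains a r c where "\<forall>x\<in>set (a # r @ [c]). 0 < x" "c < a"
    "\<pi> = perm_of_comp (a # r @ [c])" "\<kappa> \<pi> = a # r @ [c]"
    "\<Phi>\<^sub>A \<pi> = perm_of_comp ((2 * a - c) # r @ [a])"
proof -
  obtain n where "\<pi> \<in> C_av n" and len: "2 \<le> length (\<kappa> \<pi>)" and lt: "last (\<kappa> \<pi>) < hd (\<kappa> \<pi>)"
    using assms by (auto simp: dom_A_def)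
  then obtain as where as: "\<forall>a\<in>set as. 0 < a" "\<pi> = perm_of_comp as" "\<kappa> \<pi> = as"
    using C_av_cases by metis
  obtain a r' where "as = a # r'" "r' \<noteq> []"
    using len as(3) by (cases as) (auto simp: Suc_le_eq)
  then obtain r c where "as = a # r @ [c]"
    by (metis rev_exhaust)
  then show ?thesis
    using that[of a r c] as lt by (auto simp: \<Phi>\<^sub>A_def butlast_append)
qed

lemma dom_B_cases:
  assumes "\<pi> \<in> dom_B"
  obtains a b r where "\<forall>x\<in>set (a # b # r). 0 < x"
    "\<pi> = perm_of_comp (a # b # r)" "\<kappa> \<pi> = a # b # r"
    "\<Phi>\<^sub>B \<pi> = perm_of_comp ((a + 2 * b) # r @ [b])"
proof -
  obtain n where "\<pi> \<in> C_av n" and len: "2 \<le> length (\<kappa> \<pi>)"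
    using assms by (auto simp: dom_B_def)
  then obtain as where as: "\<forall>a\<in>set as. 0 < a" "\<pi> = perm_of_comp as" "\<kappa> \<pi> = as"
    using C_av_cases by metis
  obtain a b r where "as = a # b # r"
    using len as(3) by (cases as rule: remdups_adj.cases) auto
  then show ?thesis
    using that[of a b r] as by (auto simp: \<Phi>\<^sub>B_def)
qed

lemma dom_C_cases:
  assumes "\<pi> \<in> dom_C"
  obtains a r where "\<forall>x\<in>set (a # r). 0 < x"
    "\<pi> = perm_of_comp (a # r)" "\<kappa> \<pi> = a # r"
    "\<Phi>\<^sub>C \<pi> = perm_of_comp ((2 * a) # r @ [a])"
proof -
  obtain n where "\<pi> \<in> C_av n" and n: "1 \<le> n"
    using assms by (auto simp: dom_C_def)
  then obtain as where as: "\<forall>a\<in>set as. 0 < a" "sum_list as = n" "\<pi> = perm_of_comp as" "\<kappa> \<pi> = as"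
    using C_av_cases by metis
  obtain a r where "as = a # r"
    using n as(2) by (cases as) auto
  then show ?thesis
    using that[of a r] as by (auto simp: \<Phi>\<^sub>C_def)
qed

text \<open>The interior cuts keep their index, and their positions grow by $a_1-a_k$.\<close>

lemma \<Phi>\<^sub>A_preserves:
  assumes "\<pi> \<in> C_av n" "\<pi> \<in> dom_A"
  shows "\<Phi>\<^sub>A \<pi> \<in> C_av (n + 2 * (hd (\<kappa> \<pi>) - last (\<kappa> \<pi>)))"
    and "balanced \<pi> \<Longrightarrow> balanced (\<Phi>\<^sub>A \<pi>)"
proof -
  obtain a r c where \<pi>: "\<forall>x\<in>set (a # r @ [c]). 0 < x" "c < a"
    "\<pi> = perm_of_comp (a # r @ [c])" "\<kappa> \<pi> = a # r @ [c]"
    "\<Phi>\<^sub>A \<pi> = perm_of_comp ((2 * a - c) # r @ [a])"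
    using dom_A_cases[OF assms(2)] .
  have n: "n = a + sum_list r + c"
    using assms(1) \<pi>(3) by (auto simp: perm_of_comp_in_C_av_iff)
  have mem: "\<Phi>\<^sub>A \<pi> \<in> C_av (n + 2 * (a - c))"
    using C_av_enlarge_end_parts assms(1) \<pi> by simp
  then show "\<Phi>\<^sub>A \<pi> \<in> C_av (n + 2 * (hd (\<kappa> \<pi>) - last (\<kappa> \<pi>)))"
    using \<pi>(4) by simp
  assume "balanced \<pi>"
  \<comment> \<open>The cut comes after \<open>Suc i\<close> parts, so \<open>i\<close> counts only the parts taken from \<open>r\<close>.\<close>
  then obtain i where i: "i < Suc (length r)" "2 * (a + sum_list (take i r)) = n"
    using \<pi>(1,3) n unfolding \<pi>(3) balanced_perm_of_comp_iff[OF \<pi>(1)]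
    by (auto simp: Suc_le_eq gr0_conv_Suc)
  have pos: "\<forall>x\<in>set ((2 * a - c) # r @ [a]). 0 < x"
    using \<pi>(1,2) by auto
  show "balanced (\<Phi>\<^sub>A \<pi>)"
    unfolding \<pi>(5) balanced_perm_of_comp_iff[OF pos]
    using mem \<pi>(2,5) i n
    by (intro conjI exI[of _ "Suc i"]) (auto simp: perm_of_comp_in_C_av_iff)
qed

text \<open>The first two parts are merged, so a cut loses one from its index; the cut after $a_1$ is lost,
  and $2a_1\ne n$ says that it is not the balancing one. The positions of the others grow by $a_2$.\<close>

lemma \<Phi>\<^sub>B_preserves:
  assumes "\<pi> \<in> C_av n" "\<pi> \<in> dom_B"
  shows "\<Phi>\<^sub>B \<pi> \<in> C_av (n + 2 * \<kappa> \<pi> ! 1)"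
    and "balanced \<pi> \<Longrightarrow> 2 * hd (\<kappa> \<pi>) \<noteq> n \<Longrightarrow> balanced (\<Phi>\<^sub>B \<pi>)"
proof -
  obtain a b r where \<pi>: "\<forall>x\<in>set (a # b # r). 0 < x"
    "\<pi> = perm_of_comp (a # b # r)" "\<kappa> \<pi> = a # b # r"
    "\<Phi>\<^sub>B \<pi> = perm_of_comp ((a + 2 * b) # r @ [b])"
    using dom_B_cases[OF assms(2)] .
  have n: "n = a + b + sum_list r"
    using assms(1) \<pi>(2) by (auto simp: perm_of_comp_in_C_av_iff)
  have mem: "\<Phi>\<^sub>B \<pi> \<in> C_av (n + 2 * b)"
    using C_av_move_second_part assms(1) \<pi> by simp
  then show "\<Phi>\<^sub>B \<pi> \<in> C_av (n + 2 * \<kappa> \<pi> ! 1)"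
    using \<pi>(3) by simp
  assume "balanced \<pi>" and "2 * hd (\<kappa> \<pi>) \<noteq> n"
  then obtain j where j: "1 \<le> j" "j < Suc (Suc (length r))"
    "2 * sum_list (take j (a # b # r)) = n" "2 * a \<noteq> n"
    using n \<pi>(3) unfolding \<pi>(2) balanced_perm_of_comp_iff[OF \<pi>(1)] by auto
  moreover from j have "j \<noteq> 1"
    by auto
  ultimately obtain i where "j = Suc (Suc i)"
    by (metis One_nat_def not0_implies_Suc not_one_le_zero)
  then have i: "i < length r" "2 * (a + b + sum_list (take i r)) = n"
    using j by auto
  have pos: "\<forall>x\<in>set ((a + 2 * b) # r @ [b]). 0 < x"
    using \<pi>(1) by auto
  show "balanced (\<Phi>\<^sub>B \<pi>)"
    unfolding \<pi>(4) balanced_perm_of_comp_iff[OF pos]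
    using mem \<pi>(4) i n
    by (intro conjI exI[of _ "Suc i"]) (auto simp: perm_of_comp_in_C_av_iff)
qed

text \<open>The interior cuts keep their index, and their positions grow by $a_1$.\<close>

lemma \<Phi>\<^sub>C_preserves:
  assumes "\<pi> \<in> C_av n" "\<pi> \<in> dom_C"
  shows "\<Phi>\<^sub>C \<pi> \<in> C_av (n + 2 * hd (\<kappa> \<pi>))"
    and "balanced \<pi> \<Longrightarrow> balanced (\<Phi>\<^sub>C \<pi>)"
proof -
  obtain a r where \<pi>: "\<forall>x\<in>set (a # r). 0 < x"
    "\<pi> = perm_of_comp (a # r)" "\<kappa> \<pi> = a # r"
    "\<Phi>\<^sub>C \<pi> = perm_of_comp ((2 * a) # r @ [a])"
    using dom_C_cases[OF assms(2)] .
  have n: "n = a + sum_list r"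
    using assms(1) \<pi>(2) by (auto simp: perm_of_comp_in_C_av_iff)
  have mem: "\<Phi>\<^sub>C \<pi> \<in> C_av (n + 2 * a)"
    using C_av_double_first_part assms(1) \<pi> by simp
  then show "\<Phi>\<^sub>C \<pi> \<in> C_av (n + 2 * hd (\<kappa> \<pi>))"
    using \<pi>(3) by simp
  assume "balanced \<pi>"
  then obtain i where i: "i < length r" "2 * (a + sum_list (take i r)) = n"
    using n unfolding \<pi>(2) balanced_perm_of_comp_iff[OF \<pi>(1)]
    by (auto simp: Suc_le_eq gr0_conv_Suc)
  have pos: "\<forall>x\<in>set ((2 * a) # r @ [a]). 0 < x"
    using \<pi>(1) by auto
  show "balanced (\<Phi>\<^sub>C \<pi>)"
    unfolding \<pi>(4) balanced_perm_of_comp_iff[OF pos]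
    using mem \<pi>(4) i n
    by (intro conjI exI[of _ "Suc i"]) (auto simp: perm_of_comp_in_C_av_iff)
qed

lemma inj_on_\<Phi>\<^sub>A: "inj_on \<Phi>\<^sub>A dom_A"
proof (rule inj_onI)
  fix \<pi> \<rho> assume \<pi>: "\<pi> \<in> dom_A" and \<rho>: "\<rho> \<in> dom_A" and eq: "\<Phi>\<^sub>A \<pi> = \<Phi>\<^sub>A \<rho>"
  obtain a r c where 1: "\<forall>x\<in>set (a # r @ [c]). 0 < x" "c < a"
    "\<pi> = perm_of_comp (a # r @ [c])" "\<Phi>\<^sub>A \<pi> = perm_of_comp ((2 * a - c) # r @ [a])"
    using dom_A_cases[OF \<pi>] .
  obtain a' r' c' where 2: "\<forall>x\<in>set (a' # r' @ [c']). 0 < x" "c' < a'"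
    "\<rho> = perm_of_comp (a' # r' @ [c'])" "\<Phi>\<^sub>A \<rho> = perm_of_comp ((2 * a' - c') # r' @ [a'])"
    using dom_A_cases[OF \<rho>] .
  have "(2 * a - c) # r @ [a] = (2 * a' - c') # r' @ [a']"
    by (rule perm_of_comp_inject) (use 1 2 eq in auto)
  then have "2 * a - c = 2 * a' - c'" "r = r'" "a = a'"
    by auto
  moreover from this have "c = c'"
    using 1(2) 2(2) by linarith
  ultimately show "\<pi> = \<rho>"
    using 1(3) 2(3) by simp
qed

lemma inj_on_\<Phi>\<^sub>B: "inj_on \<Phi>\<^sub>B dom_B"
proof (rule inj_onI)
  fix \<pi> \<rho> assume \<pi>: "\<pi> \<in> dom_B" and \<rho>: "\<rho> \<in> dom_B" and eq: "\<Phi>\<^sub>B \<pi> = \<Phi>\<^sub>B \<rho>"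
  obtain a b r where 1: "\<forall>x\<in>set (a # b # r). 0 < x"
    "\<pi> = perm_of_comp (a # b # r)" "\<Phi>\<^sub>B \<pi> = perm_of_comp ((a + 2 * b) # r @ [b])"
    using dom_B_cases[OF \<pi>] .
  obtain a' b' r' where 2: "\<forall>x\<in>set (a' # b' # r'). 0 < x"
    "\<rho> = perm_of_comp (a' # b' # r')" "\<Phi>\<^sub>B \<rho> = perm_of_comp ((a' + 2 * b') # r' @ [b'])"
    using dom_B_cases[OF \<rho>] .
  have "(a + 2 * b) # r @ [b] = (a' + 2 * b') # r' @ [b']"
    by (rule perm_of_comp_inject) (use 1 2 eq in auto)
  then show "\<pi> = \<rho>"
    using 1 2 by auto
qed

lemma inj_on_\<Phi>\<^sub>C: "inj_on \<Phi>\<^sub>C dom_C"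
proof (rule inj_onI)
  fix \<pi> \<rho> assume \<pi>: "\<pi> \<in> dom_C" and \<rho>: "\<rho> \<in> dom_C" and eq: "\<Phi>\<^sub>C \<pi> = \<Phi>\<^sub>C \<rho>"
  obtain a r where 1: "\<forall>x\<in>set (a # r). 0 < x"
    "\<pi> = perm_of_comp (a # r)" "\<Phi>\<^sub>C \<pi> = perm_of_comp ((2 * a) # r @ [a])"
    using dom_C_cases[OF \<pi>] .
  obtain a' r' where 2: "\<forall>x\<in>set (a' # r'). 0 < x"
    "\<rho> = perm_of_comp (a' # r')" "\<Phi>\<^sub>C \<rho> = perm_of_comp ((2 * a') # r' @ [a'])"
    using dom_C_cases[OF \<rho>] .
  have "(2 * a) # r @ [a] = (2 * a') # r' @ [a']"
    by (rule perm_of_comp_inject) (use 1 2 eq in auto)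
  then show "\<pi> = \<rho>"
    using 1 2 by auto
qed

theorem lemma3p8:
  shows "(\<forall>n \<pi>. \<pi> \<in> C_av n \<and> \<pi> \<in> dom_A \<longrightarrow>
            \<Phi>\<^sub>A \<pi> \<in> C_av (n + 2 * (hd (\<kappa> \<pi>) - last (\<kappa> \<pi>))) \<and>
            (balanced \<pi> \<longrightarrow> balanced (\<Phi>\<^sub>A \<pi>)))
       \<and> (\<forall>n \<pi>. \<pi> \<in> C_av n \<and> \<pi> \<in> dom_B \<longrightarrow>
            \<Phi>\<^sub>B \<pi> \<in> C_av (n + 2 * \<kappa> \<pi> ! 1) \<and>
            (balanced \<pi> \<and> 2 * hd (\<kappa> \<pi>) \<noteq> n \<longrightarrow> balanced (\<Phi>\<^sub>B \<pi>)))
       \<and> (\<forall>n \<pi>. \<pi> \<in> C_av n \<and> \<pi> \<in> dom_C \<longrightarrow>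
            \<Phi>\<^sub>C \<pi> \<in> C_av (n + 2 * hd (\<kappa> \<pi>)) \<and>
            (balanced \<pi> \<longrightarrow> balanced (\<Phi>\<^sub>C \<pi>)))
       \<and> inj_on \<Phi>\<^sub>A dom_A \<and> inj_on \<Phi>\<^sub>B dom_B \<and> inj_on \<Phi>\<^sub>C dom_C"
  by (intro conjI allI impI inj_on_\<Phi>\<^sub>A inj_on_\<Phi>\<^sub>B inj_on_\<Phi>\<^sub>C; elim conjE)
     (rule \<Phi>\<^sub>A_preserves \<Phi>\<^sub>B_preserves \<Phi>\<^sub>C_preserves; assumption)+

end
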